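(* Let $\gamma\in(0,1)\setminus\{\tfrac12\}$. Let $n=2m$ range over even positive integers such that $\gamma m$ is an integer, and for each such $n$ let $a=a_n,\ b=b_n\in[0,m]$ with $a\neq b$. Let $c\in\{1,2\}^n$ be the balanced true label vector ($c_i=1$ for $1\le i\le m$, $c_i=2$ for $m<i\le n$), let the adjacency matrix $\tilde A\in\{0,1\}^{n\times n}$ be generated by the directed block model with edge-probability matrix $\tilde P=\frac1m\begin{pmatrix}a&b\\ b&a\end{pmatrix}$, and let the conditional pseudo-likelihood (CPL) label estimates $\hat c_i(e)$ be computed from $\tilde A$ with equal class priors $\hat\pi_1=\hat\pi_2=\tfrac12$, with parameter estimates $(\hat a,\hat b)$ and initial labeling $e$. Let $\tilde M_n(e)$ be the resulting mismatch ratio and $\tau_n^2=\frac{(a-b)^2}{a+b}$. Then there exists a sequence $\{u_n\}\subset\mathbb R_+$ (with $u_n>1$) such that $$\log u_n+\log\log u_n\ \ge\ \log\Big(\frac4e\,h(\gamma)\Big)+\frac14(1-2\gamma)^2\tau_n^2$$ and $$\mathbb P\Big[\sup_{(\hat a,\hat b)\in\mathcal P_{a,b}}\ \sup_{e\in\mathcal E^\gamma_n}\tilde M_n(e)\ \ge\ \frac{4h(\gamma)}{\log u_n}\Big]\ \le\ \exp\big(-n[h(\gamma)-\kappa_\gamma(n)]\big),$$ where $\kappa_\gamma(n):=\frac1n\Big[\log\Big(\frac{n}{4\pi\gamma(1-\gamma)}\Big)+\frac1{3n}\Big]=o(1)$. In particular, if $\tau_n^2\to\infty$, then $u_n\to\infty$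 and the CPL estimate is uniformly consistent, i.e. $\sup_{(\hat a,\hat b)\in\mathcal P_{a,b}}\sup_{e\in\mathcal E_n^\gamma}\tilde M_n(e)\to0$ in probability.
   Context: Directed block model: given the (deterministic) label vector $c\in\{1,2\}^n$, all entries $\tilde A_{ij}$, $1\le i,j\le n$ (including the diagonal), are independent with $\tilde A_{ij}\sim\mathrm{Bernoulli}(\tilde P_{c_ic_j})$. Initial labelings: $\mathcal E^\gamma_n=\{e\in\{1,2\}^n:\ \sum_{i=1}^m 1\{e_i=1\}=\gamma m=\sum_{i=m+1}^n1\{e_i=2\}\}$. Parameter estimates: $\mathcal P_{a,b}=\{(\hat a,\hat b):\ \hat a,\hat b\ge0,\ (\hat a-\hat b)(a-b)>0\}$. CPL estimate: for $e\in\mathcal E_n^\gamma$ and $(\hat a,\hat b)\in\mathcal P_{a,b}$ put - $b_{i\ell}(e)=\sum_{j=1}^n\tilde A_{ij}1\{e_j=\ell\}$ for $i\in\{1,\dots,n\}$, $\ell\in\{1,2\}$; - $R(e)$ the $2\times2$ matrix with entries $R_{k\ell}(e)=\frac1n\sum_{i=1}^n1\{e_i=k,\ c_i=\ell\}$; - $\hat P=\frac1m\begin{pmatrix}\hat a&\hat b\\ \hat b&\hat a\end{pmatrix}$; - $(\hat\theta_{k\ell}(e))$ the $2\times2$ matrix obtained from $[nR(e)\hat P]^T$ by dividing each row by its sum. Then $\hat c_i(e)=\arg\max_{k\in\{1,2\}}\big\{\log\hat\pi_k+\sum_{\ell=1}^2b_{i\ell}(e)\log\hat\theta_{k\ell}(e)\big\}$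 with $\hat\pi_1=\hat\pi_2=\frac12$ (ties broken by an arbitrary fixed rule). The estimate depends on $(\hat a,\hat b)$, although this is suppressed in the notation. Mismatch ratio: $\tilde M_n(e)=\min_{\phi}\frac1n\sum_{i=1}^n1\{\hat c_i(e)\ne\phi(c_i)\}$, the minimum being over the two permutations $\phi$ of $\{1,2\}$. $h(p)=-p\log p-(1-p)\log(1-p)$ is the binary entropy function (natural logarithm), and $e$ in $4/e$ is Euler's number. *)

theory Defs
  imports "HOL-Probability.Probability" "HOL-Library.Landau_Symbols"
begin

text \<open>
  Class labels live in the two-element type \<^typ>\<open>2\<close>, whose elements are \<open>1\<close> and \<open>2\<close>
  (the numeral \<open>2\<close> denotes the same element as \<open>0\<close>). Nodes are \<open>1, \<dots>, n\<close>, and \<open>m = n div 2\<close>.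
\<close>

definition admissible :: "real \<Rightarrow> nat set" where
  "admissible \<gamma> = {n. n > 0 \<and> even n \<and> \<gamma> * real (n div 2) \<in> \<int>}"

text \<open>Limits as \<open>n \<longrightarrow> \<infinity>\<close> through the admissible \<open>n\<close>; the filter is trivial if there are none,
  i.e. if \<open>\<gamma>\<close> is irrational.\<close>

definition along :: "real \<Rightarrow> nat filter" where
  "along \<gamma> = inf sequentially (principal (admissible \<gamma>))"

definition true_labels :: "nat \<Rightarrow> nat \<Rightarrow> 2" where
  "true_labels n i = (if i \<le> n div 2 then 1 else 2)"

definition block_matrix :: "nat \<Rightarrow> real \<Rightarrow> real \<Rightarrow> real ^ 2 ^ 2" where
  "block_matrix n a b = (1 / real (n div 2)) *\<^sub>R vector [vector [a, b], vector [b, a]]"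

text \<open>All \<open>n\<^sup>2\<close> entries are independent, and an entry \<open>True\<close> stands for \<open>1\<close>. Note that
  \<^const>\<open>bernoulli_pmf\<close> truncates parameters outside of \<open>[0, 1]\<close>, so this is only meaningful
  if the entries of \<open>P\<close> are probabilities.\<close>

definition directed_block_model ::
    "nat \<Rightarrow> (nat \<Rightarrow> 2) \<Rightarrow> real ^ 2 ^ 2 \<Rightarrow> (nat \<times> nat \<Rightarrow> bool) pmf" where
  "directed_block_model n c P =
     Pi_pmf ({1..n} \<times> {1..n}) False (\<lambda>(i, j). bernoulli_pmf (P $ c i $ c j))"

definition initial_labelings :: "real \<Rightarrow> nat \<Rightarrow> (nat \<Rightarrow> 2) set" where
  "initial_labelings \<gamma> n = {e \<in> {1..n} \<rightarrow>\<^sub>E UNIV.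
     (\<Sum>i = 1..n div 2. of_bool (e i = 1)) = \<gamma> * real (n div 2) \<and>
     \<gamma> * real (n div 2) = (\<Sum>i = n div 2 + 1..n. of_bool (e i = 2))}"

definition param_estimates :: "real \<Rightarrow> real \<Rightarrow> (real \<times> real) set" where
  "param_estimates a b = {(a', b'). a' \<ge> 0 \<and> b' \<ge> 0 \<and> (a' - b') * (a - b) > 0}"

definition block_sum :: "nat \<Rightarrow> (nat \<times> nat \<Rightarrow> bool) \<Rightarrow> (nat \<Rightarrow> 2) \<Rightarrow> nat \<Rightarrow> 2 \<Rightarrow> real" where
  "block_sum n A e i l = (\<Sum>j = 1..n. of_bool (A (i, j)) * of_bool (e j = l))"

definition overlap :: "nat \<Rightarrow> (nat \<Rightarrow> 2) \<Rightarrow> (nat \<Rightarrow> 2) \<Rightarrow> real ^ 2 ^ 2" where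
  "overlap n c e = (\<chi> k l. (1 / real n) * (\<Sum>i = 1..n. of_bool (e i = k \<and> c i = l)))"

definition row_normalize :: "real ^ 2 ^ 2 \<Rightarrow> real ^ 2 ^ 2" where
  "row_normalize T = (\<chi> k l. T $ k $ l / (\<Sum>l'\<in>UNIV. T $ k $ l'))"

definition theta_hat ::
    "nat \<Rightarrow> (nat \<Rightarrow> 2) \<Rightarrow> real \<times> real \<Rightarrow> (nat \<Rightarrow> 2) \<Rightarrow> real ^ 2 ^ 2" where
  "theta_hat n c p e =
     row_normalize (transpose ((real n *\<^sub>R overlap n c e) ** block_matrix n (fst p) (snd p)))"

text \<open>The quantity maximized over \<open>k\<close> by the CPL estimate of the label of node \<open>i\<close>, for general
  class priors \<open>\<pi>\<close>. For \<open>0 < \<gamma> < 1\<close>, \<open>c\<close> the true labels, and \<open>e\<close> and \<open>p\<close> ranging over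
  \<^const>\<open>initial_labelings\<close> and \<^const>\<open>param_estimates\<close>, all entries of \<^const>\<open>theta_hat\<close> are
  positive, so the convention \<open>ln 0 = 0\<close> plays no role.\<close>

definition cpl_score ::
    "nat \<Rightarrow> (nat \<Rightarrow> 2) \<Rightarrow> (2 \<Rightarrow> real) \<Rightarrow> real \<times> real \<Rightarrow> (nat \<Rightarrow> 2) \<Rightarrow> (nat \<times> nat \<Rightarrow> bool) \<Rightarrow>
     nat \<Rightarrow> 2 \<Rightarrow> real" where
  "cpl_score n c \<pi> p e A i k =
     ln (\<pi> k) + (\<Sum>l\<in>UNIV. block_sum n A e i l * ln (theta_hat n c p e $ k $ l))"

text \<open>A CPL estimate with equal priors maps the adjacency matrix, the parameter estimates
  and the initial labeling to labels attaining the maximal score. The choice between tied labels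
  is whatever the function \<open>est\<close> happens to do.\<close>

definition cpl_estimate ::
    "real \<Rightarrow> nat \<Rightarrow> real \<Rightarrow> real \<Rightarrow>
     ((nat \<times> nat \<Rightarrow> bool) \<Rightarrow> real \<times> real \<Rightarrow> (nat \<Rightarrow> 2) \<Rightarrow> nat \<Rightarrow> 2) \<Rightarrow> bool" where
  "cpl_estimate \<gamma> n a b est \<longleftrightarrow>
     (\<forall>A. \<forall>p \<in> param_estimates a b. \<forall>e \<in> initial_labelings \<gamma> n. \<forall>i \<in> {1..n}.
        is_arg_max (cpl_score n (true_labels n) (\<lambda>_. 1/2) p e A i) (\<lambda>_. True) (est A p e i))"

definition mismatch :: "nat \<Rightarrow> (nat \<Rightarrow> 2) \<Rightarrow> (nat \<Rightarrow> 2) \<Rightarrow> real" where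
  "mismatch n c c' =
     (MIN \<phi>\<in>{\<phi>. bij \<phi>}. (1 / real n) * (\<Sum>i = 1..n. of_bool (c' i \<noteq> \<phi> (c i))))"

definition sup_mismatch ::
    "real \<Rightarrow> nat \<Rightarrow> real \<Rightarrow> real \<Rightarrow>
     ((nat \<times> nat \<Rightarrow> bool) \<Rightarrow> real \<times> real \<Rightarrow> (nat \<Rightarrow> 2) \<Rightarrow> nat \<Rightarrow> 2) \<Rightarrow>
     (nat \<times> nat \<Rightarrow> bool) \<Rightarrow> real" where
  "sup_mismatch \<gamma> n a b est A =
     (SUP p \<in> param_estimates a b. SUP e \<in> initial_labelings \<gamma> n.
        mismatch n (true_labels n) (est A p e))"

definition binary_entropy :: "real \<Rightarrow> real" where
  "binary_entropy p = - p * ln p - (1 - p) * ln (1 - p)"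

definition tau_sq :: "real \<Rightarrow> real \<Rightarrow> real" where
  "tau_sq a b = (a - b)\<^sup>2 / (a + b)"

definition kappa :: "real \<Rightarrow> nat \<Rightarrow> real" where
  "kappa \<gamma> n = (1 / real n) * (ln (real n / (4 * pi * \<gamma> * (1 - \<gamma>))) + 1 / (3 * real n))"

end

(*
  For an initial labeling e the matrix theta_hat is symmetric with equal diagonal entries, and
  log (theta_11 / theta_12) has the sign of (2 gamma - 1) (a - b) for all parameter estimates.
  Hence node i can be misclassified only if the sum over j of w_ij A_ij is nonpositive, where the
  w_ij = +-1 depend on e but not on the parameter estimates. By the Chernoff bound this has
  probability at most p = exp (- (1 - 2 gamma)^2 tau^2 / 4), and the rows of A are independent, so
  the number of such nodes exceeds n x with probability at most (exp 1 p / x)^(n x).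
  With log u + log log u = log (4 h / exp 1) - log p and x = 4 h / log u this bound equals
  exp (- 4 n h), which beats the number of initial labelings, at most exp (n h).
*)
theory Submission
  imports Defs "HOL-Real_Asymp.Real_Asymp"
begin

section \<open>Exponential moments of Bernoulli matrices and the number of rows with nonpositive
  weighted sum\<close>

lemma exp_le_quadratic:
  fixes x :: real
  assumes "\<bar>x\<bar> \<le> 1"
  shows "exp x \<le> 1 + x + x\<^sup>2"
proof (cases "x \<ge> 0")
  case True
  then show ?thesis using assms exp_bound[of x] by simp
next
  case False
  define y where "y = - x"
  have y: "y > 0" using False by (simp add: y_def)
  \<comment> \<open>For x = - y the claim becomes 1 <= (1 - y + y^2) exp y, and 1 + y <= exp y
    reduces it to the factorization of 1 + y^3.\<close>
  have "1 \<le> 1 + y ^ 3" using y by simp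
  also have "\<dots> = (1 - y + y\<^sup>2) * (1 + y)" by (simp add: power2_eq_square power3_eq_cube algebra_simps)
  also have "\<dots> \<le> (1 - y + y\<^sup>2) * exp y"
  proof (rule mult_left_mono)
    show "0 \<le> 1 - y + y\<^sup>2" using assms unfolding y_def abs_le_iff by simp
  qed (rule exp_ge_add_one_self)
  finally have "exp (- y) \<le> (1 - y + y\<^sup>2) * exp y * exp (- y)"
    by (metis exp_ge_zero mult.left_neutral mult_right_mono)
  also have "\<dots> = 1 - y + y\<^sup>2" by (simp add: exp_minus)
  finally show ?thesis by (simp add: y_def)
qed

lemma expectation_bernoulli_exp_le:
  assumes "0 \<le> q" "q \<le> 1"
  shows "measure_pmf.expectation (bernoulli_pmf q) (\<lambda>v. exp (t * of_bool v)) \<le> exp (q * (exp t - 1))"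
proof -
  have "measure_pmf.expectation (bernoulli_pmf q) (\<lambda>v. exp (t * of_bool v)) = 1 + q * (exp t - 1)"
    using assms by (simp add: integral_bernoulli_pmf algebra_simps)
  also have "\<dots> \<le> exp (q * (exp t - 1))" by (rule exp_ge_add_one_self)
  finally show ?thesis .
qed

text \<open>Here \<mu> is the Chernoff parameter, common to all rows. By
  \<open>expectation_bernoulli_exp_le\<close> the left side of the assumption on L bounds the
  logarithm of the exponential moment of row i, so each row contributes a factor at most exp (-
  L).\<close>

context
  fixes I J :: "nat set" and q w :: "nat \<Rightarrow> nat \<Rightarrow> real" and L \<mu> :: real
  assumes fin: "finite I" "finite J"
    and q: "\<And>i j. i \<in> I \<Longrightarrow> j \<in> J \<Longrightarrow> 0 \<le> q i j \<and> q i j \<le> 1"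
    and \<mu>: "\<mu> \<ge> 0"
    and L: "\<And>i. i \<in> I \<Longrightarrow> (\<Sum>j\<in>J. q i j * (exp (- \<mu> * w i j) - 1)) \<le> - L"
begin

abbreviation bernoulli_matrix :: "(nat \<times> nat \<Rightarrow> bool) pmf" where
  "bernoulli_matrix \<equiv> Pi_pmf (I \<times> J) False (\<lambda>(i, j). bernoulli_pmf (q i j))"

lemma integrable_bernoulli_matrix:
  fixes f :: "(nat \<times> nat \<Rightarrow> bool) \<Rightarrow> real"
  shows "integrable (measure_pmf bernoulli_matrix) f"
proof (rule integrable_measure_pmf_finite)
  show "finite (set_pmf bernoulli_matrix)"
    using fin by (subst set_Pi_pmf) (auto intro!: finite_PiE_dflt)
qed

lemma expectation_rows_le:
  assumes "T \<subseteq> I"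
  shows "measure_pmf.expectation bernoulli_matrix
           (\<lambda>A. \<Prod>i\<in>T. exp (- \<mu> * (\<Sum>j\<in>J. w i j * of_bool (A (i, j))))) \<le> exp (- L) ^ card T"
proof -
  \<comment> \<open>Exponent 0 outside the rows in T extends the product to all of I x J, where
    independence of the entries factorizes the expectation.\<close>
  define t where "t i j = (if i \<in> T then - \<mu> * w i j else 0)" for i j
  have eq: "(\<Prod>i\<in>T. exp (- \<mu> * (\<Sum>j\<in>J. w i j * of_bool (A (i, j))))) =
      (\<Prod>x\<in>I \<times> J. exp (t (fst x) (snd x) * of_bool (A x)))" for A
  proof -
    have "(\<Prod>i\<in>T. exp (- \<mu> * (\<Sum>j\<in>J. w i j * of_bool (A (i, j))))) =
        (\<Prod>i\<in>T. \<Prod>j\<in>J. exp (t i j * of_bool (A (i, j))))"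
      by (intro prod.cong refl)
        (simp add: t_def exp_sum[OF fin(2), symmetric] sum_distrib_left algebra_simps sum_negf)
    also have "\<dots> = (\<Prod>i\<in>I. \<Prod>j\<in>J. exp (t i j * of_bool (A (i, j))))"
      using fin assms by (intro prod.mono_neutral_left) (auto simp: t_def)
    finally show ?thesis by (simp add: prod.cartesian_product case_prod_beta')
  qed
  have "measure_pmf.expectation bernoulli_matrix
           (\<lambda>A. \<Prod>i\<in>T. exp (- \<mu> * (\<Sum>j\<in>J. w i j * of_bool (A (i, j))))) =
        (\<Prod>x\<in>I \<times> J. measure_pmf.expectation (case x of (i, j) \<Rightarrow> bernoulli_pmf (q i j))
          (\<lambda>v. exp (t (fst x) (snd x) * of_bool v)))"
    unfolding eq using fin
    by (intro expectation_prod_Pi_pmf) (auto intro!: integrable_measure_pmf_finite)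
  also have "\<dots> \<le> (\<Prod>x\<in>I \<times> J. exp (q (fst x) (snd x) * (exp (t (fst x) (snd x)) - 1)))"
    using q
    by (intro prod_mono conjI integral_nonneg)
      (auto simp del: integral_bernoulli_pmf intro!: expectation_bernoulli_exp_le)
  also have "\<dots> = (\<Prod>i\<in>I. exp (\<Sum>j\<in>J. q i j * (exp (t i j) - 1)))"
    using fin by (simp add: exp_sum prod.cartesian_product case_prod_beta')
  also have "\<dots> = (\<Prod>i\<in>T. exp (\<Sum>j\<in>J. q i j * (exp (t i j) - 1)))"
    using fin assms by (intro prod.mono_neutral_right) (auto simp: t_def)
  also have "\<dots> \<le> (\<Prod>i\<in>T. exp (- L))"
    using assms L by (intro prod_mono) (auto simp: t_def)
  finally show ?thesis by simp
qed

text \<open>Markov's inequality for the exponential moment of the number of rows with nonpositive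
  weighted sum; each indicator of such a row is bounded by an exponential, and the product over
  the rows is expanded into a sum over sets of rows.\<close>

lemma prob_many_nonpos_rows_le:
  assumes "I \<noteq> {}" and k: "k > 0" and large: "ln (k / card I) + L \<ge> 0"
  shows "measure_pmf.prob bernoulli_matrix
      {A. real (card {i\<in>I. (\<Sum>j\<in>J. w i j * of_bool (A (i, j))) \<le> 0}) \<ge> k}
    \<le> exp (- k * (ln (k / card I) + L - 1))"
proof -
  define Y where "Y A i = (\<Sum>j\<in>J. w i j * of_bool (A (i, j)))" for A i
  \<comment> \<open>This z minimizes exp (N exp (- L) exp z - z k) with N = \<open>card I\<close>;
    at the minimum N exp (- L) exp z equals k, which is \<open>z_eq\<close>.\<close>
  define z where "z = ln (k / card I) + L"
  have N: "real (card I) > 0" using assms fin by (simp add: card_gt_0_iff)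
  have z1: "exp z - 1 \<ge> 0" using large by (simp add: z_def)
  have z_eq: "card I * (exp (- L) * exp z) = k"
    using N k unfolding z_def exp_add by (simp add: exp_minus)
  define F where "F A = (\<Prod>i\<in>I. (exp z - 1) * exp (- \<mu> * Y A i) + 1)" for A
  let ?S = "{A. real (card {i\<in>I. Y A i \<le> 0}) \<ge> k}"
  have pointwise: "indicator ?S A \<le> exp (- z * k) * F A" for A
  proof (cases "A \<in> ?S")
    case True
    have "exp (z * k) \<le> exp (z * card {i\<in>I. Y A i \<le> 0})"
      using True large by (auto simp: z_def intro!: mult_left_mono)
    also have "\<dots> = (\<Prod>i\<in>I. if Y A i \<le> 0 then exp z else 1)"
      using fin by (simp add: prod.If_cases exp_of_nat_mult[symmetric] mult.commute Int_def)
    also have "\<dots> \<le> F A"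
      unfolding F_def
    proof (intro prod_mono conjI)
      fix i
      \<comment> \<open>A row with positive sum still has a factor at least 1, because z >= 0; this
        is where \<open>large\<close> enters.\<close>
      show "(if Y A i \<le> 0 then exp z else 1) \<le> (exp z - 1) * exp (- \<mu> * Y A i) + 1"
      proof (cases "Y A i \<le> 0")
        case True
        then have "1 \<le> exp (- \<mu> * Y A i)" using \<mu> by (simp add: mult_nonneg_nonpos)
        then have "(exp z - 1) * 1 \<le> (exp z - 1) * exp (- \<mu> * Y A i)"
          using z1 by (rule mult_left_mono)
        then show ?thesis using True by simp
      qed (use z1 in auto)
    qed auto
    finally have "exp (- z * k) * exp (z * k) \<le> exp (- z * k) * F A" by simp
    then show ?thesis using True by (simp add: exp_minus)
  next
    case False
    have "F A \<ge> 0"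
    unfolding F_def by (intro prod_nonneg add_nonneg_nonneg mult_nonneg_nonneg z1) auto
  then show ?thesis using False by simp
  qed
  have "measure_pmf.prob bernoulli_matrix ?S = measure_pmf.expectation bernoulli_matrix (indicator ?S)"
    by simp
  also have "\<dots> \<le> measure_pmf.expectation bernoulli_matrix (\<lambda>A. exp (- z * k) * F A)"
    by (intro integral_mono integrable_bernoulli_matrix pointwise)
  also have "\<dots> = exp (- z * k) * measure_pmf.expectation bernoulli_matrix
      (\<lambda>A. \<Sum>T\<in>Pow I. (exp z - 1) ^ card T * (\<Prod>i\<in>T. exp (- \<mu> * Y A i)))"
    unfolding F_def prod_add[OF fin(1)] by (simp add: prod.distrib)
  also have "measure_pmf.expectation bernoulli_matrix
      (\<lambda>A. \<Sum>T\<in>Pow I. (exp z - 1) ^ card T * (\<Prod>i\<in>T. exp (- \<mu> * Y A i))) =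
      (\<Sum>T\<in>Pow I. (exp z - 1) ^ card T *
        measure_pmf.expectation bernoulli_matrix (\<lambda>A. \<Prod>i\<in>T. exp (- \<mu> * Y A i)))"
    by (subst Bochner_Integration.integral_sum) (auto intro: integrable_bernoulli_matrix)
  also have "\<dots> \<le> (\<Sum>T\<in>Pow I. (exp z - 1) ^ card T * exp (- L) ^ card T)"
    unfolding Y_def using z1 by (intro sum_mono mult_left_mono expectation_rows_le) auto
  \<comment> \<open>The expansion over sets of rows is folded back into a product, as if the rows
    had moments exactly exp (- L).\<close>
  also have "\<dots> = (\<Prod>i\<in>I. (exp z - 1) * exp (- L) + 1)"
    unfolding prod_add[OF fin(1)] by (simp add: power_mult_distrib)
  also have "\<dots> \<le> (\<Prod>i\<in>I. exp (exp z * exp (- L)))"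
  proof (intro prod_mono conjI)
    have "(exp z - 1) * exp (- L) + 1 \<le> 1 + exp z * exp (- L)"
      by (simp add: algebra_simps)
    also have "\<dots> \<le> exp (exp z * exp (- L))" by (rule exp_ge_add_one_self)
    finally show "(exp z - 1) * exp (- L) + 1 \<le> exp (exp z * exp (- L))" .
  qed (use z1 in auto)
  also have "\<dots> = exp k"
    using z_eq by (simp add: exp_of_nat_mult[symmetric] mult.commute mult.left_commute)
  finally have "measure_pmf.prob bernoulli_matrix ?S \<le> exp (- z * k) * exp k" by simp
  also have "\<dots> = exp (- k * (z - 1))" by (simp add: exp_add[symmetric] algebra_simps)
  finally show ?thesis by (simp add: Y_def z_def)
qed

end

section \<open>CPL scores and row sums in terms of label signs\<close>

definition label_sign :: "2 \<Rightarrow> real" where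
  "label_sign l = (if l = 1 then 1 else - 1)"

lemma label_sign_simps [simp]: "label_sign 1 = 1" "label_sign 2 = - 1"
  by (simp_all add: label_sign_def)

lemma label_sign_mult_self [simp]: "label_sign l * label_sign l = 1"
  by (simp add: label_sign_def)

text \<open>Turns counts of labels into polynomials in the signs, so that all of them reduce to the
  sums in \<open>sum_label_sign_true_labels\<close> and \<open>label_sign_sums\<close>.\<close>

lemma of_bool_eq_label_sign: "of_bool (k = l) = (1 + label_sign k * label_sign l) / 2"
  using exhaust_2[of k] exhaust_2[of l] by auto

lemma label_sign_neq: "k \<noteq> l \<Longrightarrow> label_sign k = - label_sign l"
  using exhaust_2[of k] exhaust_2[of l] by auto

lemma sum_split_half:
  fixes f :: "nat \<Rightarrow> 'a :: comm_monoid_add"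
  shows "(\<Sum>i = 1..n. f i) = (\<Sum>i = 1..n div 2. f i) + (\<Sum>i = n div 2 + 1..n. f i)"
  using sum.ub_add_nat[of 1 "n div 2" f "n - n div 2"] by simp

lemma sum_true_labels_split:
  "(\<Sum>j = 1..n. label_sign (true_labels n j) * f j) =
     (\<Sum>j = 1..n div 2. f j) - (\<Sum>j = n div 2 + 1..n. f j)"
  by (subst sum_split_half) (simp add: true_labels_def sum_negf)

lemma sum_label_sign_true_labels:
  assumes "even n"
  shows "(\<Sum>j = 1..n. label_sign (true_labels n j)) = 0"
proof -
  have "real (n - n div 2) = real (n div 2)" using assms by (auto elim!: evenE)
  then show ?thesis using sum_true_labels_split[of n "\<lambda>_. 1"] by simp
qed

text \<open>The signs of e sum to (2 \<gamma> - 1) m over the first half of the nodes and to minus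
  that over the second. The halves cancel in the first claim; in the second the true labels flip the
  second half, so they add up.\<close>

lemma label_sign_sums:
  assumes n: "n \<in> admissible \<gamma>" and e: "e \<in> initial_labelings \<gamma> n"
  shows "(\<Sum>j = 1..n. label_sign (e j)) = 0"
    and "(\<Sum>j = 1..n. label_sign (true_labels n j) * label_sign (e j)) = (2 * \<gamma> - 1) * n"
proof -
  define m where "m = n div 2"
  have n_eq: "n = 2 * m" using n by (auto simp: admissible_def m_def)
  have e1: "(\<Sum>j = 1..m. of_bool (e j = 1)) = \<gamma> * m" and e2: "(\<Sum>j = m + 1..n. of_bool (e j = 2)) = \<gamma> * m"
    using e by (auto simp: initial_labelings_def m_def)
  have "(\<Sum>j = 1..m. label_sign (e j)) = (\<Sum>j = 1..m. 2 * of_bool (e j = 1) - 1)"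
    by (intro sum.cong refl) (simp add: label_sign_def)
  also have "\<dots> = (2 * \<gamma> - 1) * m"
    by (simp only: sum_subtractf sum_distrib_left[symmetric] e1) (simp add: algebra_simps)
  finally have s1: "(\<Sum>j = 1..m. label_sign (e j)) = (2 * \<gamma> - 1) * m" .
  have "label_sign k = 1 - 2 * of_bool (k = 2)" for k
    using exhaust_2[of k] by auto
  then have "(\<Sum>j = m + 1..n. label_sign (e j)) = (\<Sum>j = m + 1..n. 1 - 2 * of_bool (e j = 2))"
    by (intro sum.cong refl)
  also have "\<dots> = - ((2 * \<gamma> - 1) * m)"
    by (simp only: sum_subtractf sum_distrib_left[symmetric] e2) (simp add: algebra_simps n_eq)
  finally have s2: "(\<Sum>j = m + 1..n. label_sign (e j)) = - ((2 * \<gamma> - 1) * m)" .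
  show "(\<Sum>j = 1..n. label_sign (e j)) = 0"
    using s1 s2 by (subst sum_split_half) (simp add: m_def)
  show "(\<Sum>j = 1..n. label_sign (true_labels n j) * label_sign (e j)) = (2 * \<gamma> - 1) * n"
    unfolding sum_true_labels_split m_def[symmetric] s1 s2 by (simp add: n_eq algebra_simps)
qed

lemma overlap_nth:
  assumes n: "n \<in> admissible \<gamma>" and e: "e \<in> initial_labelings \<gamma> n"
  shows "real n * overlap n (true_labels n) e $ k $ l =
    n / 4 * (1 + label_sign k * label_sign l * (2 * \<gamma> - 1))"
proof -
  have n0: "even n" "n > 0" using n by (auto simp: admissible_def)
  have "real n * overlap n (true_labels n) e $ k $ l =
      (\<Sum>i = 1..n. of_bool (e i = k) * of_bool (true_labels n i = l))"
    using n0 by (simp add: overlap_def of_bool_conj)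
  \<comment> \<open>Product of two indicators in sign form: the two terms with a single sign sum to
    zero, which leaves the constant and the correlation of e with the true labels.\<close>
  also have "\<dots> = (\<Sum>i = 1..n. 1 / 4 + label_sign k / 4 * label_sign (e i)
        + label_sign l / 4 * label_sign (true_labels n i)
        + label_sign k * label_sign l / 4 * (label_sign (true_labels n i) * label_sign (e i)))"
    by (simp add: of_bool_eq_label_sign algebra_simps add_divide_distrib)
  also have "\<dots> = n / 4 * (1 + label_sign k * label_sign l * (2 * \<gamma> - 1))"
    unfolding sum.distrib sum_distrib_left[symmetric] label_sign_sums[OF assms]
      sum_label_sign_true_labels[OF n0(1)]
    by (simp add: algebra_simps)
  finally show ?thesis .
qed

lemma block_matrix_nth:
  assumes "even n"
  shows "block_matrix n a b $ k $ l = (a + b + (a - b) * (label_sign k * label_sign l)) / n"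
  using exhaust_2[of k] exhaust_2[of l] assms
  by (auto simp: block_matrix_def vector_2 elim!: evenE)

text \<open>Both factors have entries of the form x + y s_k s_l with label signs s. Such matrices
  are closed under multiplication: the cross terms cancel in the sum over the middle index. The sign
  terms also cancel in each row sum, so normalizing divides by a + b.\<close>

lemma theta_hat_nth:
  assumes n: "n \<in> admissible \<gamma>" and e: "e \<in> initial_labelings \<gamma> n" and pos: "a + b > 0"
  shows "theta_hat n (true_labels n) (a, b) e $ k $ l =
    (1 + label_sign k * label_sign l * ((2 * \<gamma> - 1) * (a - b) / (a + b))) / 2"
proof -
  have n0: "even n" "n > 0" using n by (auto simp: admissible_def)
  let ?T = "transpose ((real n *\<^sub>R overlap n (true_labels n) e) ** block_matrix n a b)"
  define A B where "A = a + b" and "B = (2 * \<gamma> - 1) * (a - b)"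
  have T: "?T $ k $ l = (A + label_sign k * label_sign l * B) / 2" for k l
  proof -
    have cancel: "real n / 4 * x * (y / real n) = x * y / 4" for x y using n0 by simp
    show ?thesis
      by (simp only: transpose_def matrix_matrix_mult_def sum_2 vec_lambda_beta
          vector_scaleR_component real_scaleR_def overlap_nth[OF n e] block_matrix_nth[OF n0(1)]
          cancel label_sign_simps)
        (simp add: A_def B_def field_simps)
  qed
  have "(\<Sum>l\<in>UNIV. ?T $ k $ l) = A" by (simp add: sum_2 T field_simps)
  then have "theta_hat n (true_labels n) (a, b) e $ k $ l = (A + label_sign k * label_sign l * B) / 2 / A"
    by (simp add: theta_hat_def row_normalize_def T)
  also have "\<dots> = (1 + label_sign k * label_sign l * (B / A)) / 2"
    using pos by (simp add: A_def[symmetric] field_simps)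
  finally show ?thesis by (simp only: A_def B_def)
qed

text \<open>The equal priors cancel. Since \<open>theta_hat\<close> has equal diagonal and equal
  off-diagonal entries, the coefficients of the two block sums are opposite, and only their
  difference remains.\<close>

lemma cpl_score_diff:
  assumes n: "n \<in> admissible \<gamma>" and e: "e \<in> initial_labelings \<gamma> n" and pos: "a + b > 0"
    and \<rho>: "\<rho> = (2 * \<gamma> - 1) * (a - b) / (a + b)"
  shows "cpl_score n (true_labels n) (\<lambda>_. 1/2) (a, b) e A i 1
      - cpl_score n (true_labels n) (\<lambda>_. 1/2) (a, b) e A i 2
    = (\<Sum>j = 1..n. label_sign (e j) * of_bool (A (i, j))) * (ln ((1 + \<rho>) / 2) - ln ((1 - \<rho>) / 2))"
proof -
  have eq: "(\<Sum>j = 1..n. label_sign (e j) * of_bool (A (i, j))) = block_sum n A e i 1 - block_sum n A e i 2"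
    unfolding block_sum_def sum_subtractf[symmetric]
    by (intro sum.cong refl) (auto simp: of_bool_eq_label_sign field_simps)
  show ?thesis
    unfolding eq cpl_score_def sum_2 theta_hat_nth[OF n e pos] \<rho>[symmetric]
    by (simp add: algebra_simps)
qed

lemma cpl_error_imp_nonpos:
  assumes n: "n \<in> admissible \<gamma>" and e: "e \<in> initial_labelings \<gamma> n"
    and p: "p \<in> param_estimates a b" and \<gamma>: "0 < \<gamma>" "\<gamma> < 1"
    and max: "is_arg_max (cpl_score n (true_labels n) (\<lambda>_. 1/2) p e A i) (\<lambda>_. True) k"
    and err: "k \<noteq> true_labels n i"
  shows "(\<Sum>j = 1..n. sgn ((2 * \<gamma> - 1) * (a - b)) * label_sign (true_labels n i) * label_sign (e j)
            * of_bool (A (i, j))) \<le> 0"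
proof -
  obtain a' b' where p_eq: "p = (a', b')" by (cases p)
  have ab': "a' \<ge> 0" "b' \<ge> 0" "(a' - b') * (a - b) > 0"
    using p by (auto simp: param_estimates_def p_eq)
  then have pos: "a' + b' > 0" by (cases "a' = 0 \<and> b' = 0") auto
  define \<rho> where "\<rho> = (2 * \<gamma> - 1) * (a' - b') / (a' + b')"
  define S where "S = (\<Sum>j = 1..n. label_sign (e j) * of_bool (A (i, j)))"
  define \<Delta> where "\<Delta> = ln ((1 + \<rho>) / 2) - ln ((1 - \<rho>) / 2)"
  let ?c = "label_sign (true_labels n i)"
  let ?s = "cpl_score n (true_labels n) (\<lambda>_. 1/2) p e A i"
  have diff: "?s 1 - ?s 2 = S * \<Delta>"
    using cpl_score_diff[OF n e pos \<rho>_def] by (simp add: S_def \<Delta>_def p_eq)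
  \<comment> \<open>The maximizer has a score at least that of the other label, however ties are
    broken; an erroneous label has the sign opposite to the true one, which reverses the
    inequality.\<close>
  have "0 \<le> label_sign k * (?s 1 - ?s 2)"
    using max exhaust_2[of k] by (auto simp: is_arg_max_def not_less)
  then have 1: "?c * S * \<Delta> \<le> 0"
    using label_sign_neq[OF err] by (simp add: diff)
  \<comment> \<open>The bound on \<rho> makes both logarithms in \<Delta> meaningful, so that
    monotonicity of the logarithm gives \<Delta> the sign of \<rho>.\<close>
  have "\<bar>\<rho>\<bar> = \<bar>2 * \<gamma> - 1\<bar> * (\<bar>a' - b'\<bar> / (a' + b'))"
    using pos by (simp add: \<rho>_def abs_mult)
  also have "\<dots> \<le> \<bar>2 * \<gamma> - 1\<bar> * 1"
    using pos ab' by (intro mult_left_mono) auto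
  also have "\<dots> < 1" using \<gamma> by auto
  finally have "\<bar>\<rho>\<bar> < 1" .
  then have "sgn \<Delta> = sgn \<rho>"
    unfolding \<Delta>_def by (auto simp: sgn_if)
  \<comment> \<open>The parameter estimates drop out here: \<open>param_estimates\<close> forces a'
    - b' to have the sign of a - b.\<close>
  also have "\<dots> = sgn ((2 * \<gamma> - 1) * (a - b))"
    using pos ab'(3) by (auto simp: \<rho>_def sgn_mult sgn_divide zero_less_mult_iff)
  finally have sgn: "sgn ((2 * \<gamma> - 1) * (a - b)) = sgn \<Delta>" ..
  have "(\<Sum>j = 1..n. sgn ((2 * \<gamma> - 1) * (a - b)) * ?c * label_sign (e j) * of_bool (A (i, j)))
      = sgn \<Delta> * (?c * S)"
    by (simp only: S_def sgn sum_distrib_left mult.assoc)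
  also have "\<dots> \<le> 0" using 1
    by (auto simp: sgn_if mult_le_0_iff)
  finally show ?thesis .
qed

text \<open>The expected row sum is a + b and the expected weighted row sum is t. The quadratic
  bound on exp turns the exponent into \<mu>^2 (a + b) - \<mu> t, whose minimizer is the chosen
  \<mu>; the value - t^2 / (4 (a + b)) is the source of the constant 1/4.\<close>

lemma row_exponent_le:
  fixes n :: nat and \<gamma> a b :: real and e :: "nat \<Rightarrow> 2"
  defines "q \<equiv> \<lambda>i j. block_matrix n a b $ true_labels n i $ true_labels n j"
    and "w \<equiv> \<lambda>i j. sgn ((2 * \<gamma> - 1) * (a - b)) * label_sign (true_labels n i) * label_sign (e j)"
    and "t \<equiv> \<bar>(2 * \<gamma> - 1) * (a - b)\<bar>"
  defines "\<mu> \<equiv> t / (2 * (a + b))"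
  assumes n: "n \<in> admissible \<gamma>" and e: "e \<in> initial_labelings \<gamma> n"
    and \<gamma>: "0 < \<gamma>" "\<gamma> < 1" and ab: "a \<ge> 0" "b \<ge> 0" "a \<noteq> b"
  shows "(\<Sum>j = 1..n. q i j * (exp (- \<mu> * w i j) - 1)) \<le> - (1/4 * (1 - 2 * \<gamma>)\<^sup>2 * tau_sq a b)"
proof -
  have n0: "even n" "n > 0" using n by (auto simp: admissible_def)
  have pos: "a + b > 0" using ab by (cases "a = 0 \<and> b = 0") auto
  define \<delta> where "\<delta> = sgn ((2 * \<gamma> - 1) * (a - b))"
  have q_eq: "q i j = (a + b + (a - b) * (label_sign (true_labels n i) * label_sign (true_labels n j))) / n" for j
    unfolding q_def block_matrix_nth[OF n0(1)] ..
  have q0: "q i j \<ge> 0" for j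
    using ab unfolding q_eq by (auto simp: label_sign_def)
  \<comment> \<open>Ensures that the optimal \<mu> lies in the range where
    \<open>exp_le_quadratic\<close> applies.\<close>
  have "t \<le> 1 * (a + b)"
    unfolding t_def abs_mult using ab \<gamma> by (intro mult_mono) auto
  then have \<mu>01: "\<mu> \<ge> 0" "\<mu> \<le> 1" using pos by (auto simp: \<mu>_def t_def)
  have w1: "\<bar>w i j\<bar> \<le> 1" for j
    by (auto simp: w_def label_sign_def sgn_if)
  have "(\<Sum>j = 1..n. q i j * (exp (- \<mu> * w i j) - 1)) \<le> (\<Sum>j = 1..n. q i j * (\<mu>\<^sup>2 - \<mu> * w i j))"
  proof (intro sum_mono mult_left_mono q0)
    fix j
    have w2: "(w i j)\<^sup>2 \<le> 1" using w1 by (simp add: abs_square_le_1)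
    have "exp (- \<mu> * w i j) \<le> 1 + (- \<mu> * w i j) + (- \<mu> * w i j)\<^sup>2"
      using \<mu>01 w1[of j] by (intro exp_le_quadratic) (simp add: abs_mult mult_le_one)
    moreover have "(- \<mu> * w i j)\<^sup>2 \<le> \<mu>\<^sup>2"
      using mult_left_mono[OF w2, of "\<mu>\<^sup>2"] by (simp add: power_mult_distrib)
    ultimately show "exp (- \<mu> * w i j) - 1 \<le> \<mu>\<^sup>2 - \<mu> * w i j" by simp
  qed
  also have "\<dots> = \<mu>\<^sup>2 * (\<Sum>j = 1..n. q i j) - \<mu> * (\<Sum>j = 1..n. q i j * w i j)"
    by (simp add: sum_distrib_left sum_subtractf algebra_simps)
  also have "(\<Sum>j = 1..n. q i j) = a + b"
  proof -
    have "(\<Sum>j = 1..n. q i j) = (\<Sum>j = 1..n. (a + b) / n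
        + (a - b) / n * label_sign (true_labels n i) * label_sign (true_labels n j))"
      by (simp add: q_eq add_divide_distrib diff_divide_distrib algebra_simps)
    also have "\<dots> = a + b"
      unfolding sum.distrib sum_distrib_left[symmetric] sum_label_sign_true_labels[OF n0(1)]
      using n0 by simp
    finally show ?thesis .
  qed
  also have "(\<Sum>j = 1..n. q i j * w i j) = t"
  proof -
    \<comment> \<open>With c * c = 1, the product splits into a term linear in the sign of e j,
      which sums to zero over j, and a term whose sum is the correlation of e with the true
      labels.\<close>
    have expand: "(x + y * (c * c')) / n * (\<delta> * c * d) = x * \<delta> * c / n * d + y * \<delta> / n * (c' * d) * (c * c)"
      for x y c c' d :: real
      by (simp add: divide_inverse algebra_simps)
    have "(\<Sum>j = 1..n. q i j * w i j) = (\<Sum>j = 1..n.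
        (a + b) * \<delta> * label_sign (true_labels n i) / n * label_sign (e j)
        + (a - b) * \<delta> / n * (label_sign (true_labels n j) * label_sign (e j)))"
    proof (intro sum.cong refl)
      fix j
      have "q i j * w i j = (a + b) * \<delta> * label_sign (true_labels n i) / n * label_sign (e j)
          + (a - b) * \<delta> / n * (label_sign (true_labels n j) * label_sign (e j))
            * (label_sign (true_labels n i) * label_sign (true_labels n i))"
        unfolding q_eq w_def \<delta>_def[symmetric] by (rule expand)
      then show "q i j * w i j = (a + b) * \<delta> * label_sign (true_labels n i) / n * label_sign (e j)
          + (a - b) * \<delta> / n * (label_sign (true_labels n j) * label_sign (e j))"
        by simp
    qed
    also have "\<dots> = (2 * \<gamma> - 1) * (a - b) * \<delta>"
      unfolding sum.distrib sum_distrib_left[symmetric] label_sign_sums[OF n e]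
      using n0 by simp
    also have "\<dots> = t" unfolding \<delta>_def t_def by (rule linordered_idom_class.abs_sgn[symmetric])
    finally show ?thesis .
  qed
  also have "\<mu>\<^sup>2 * (a + b) - \<mu> * t = - (t\<^sup>2 / (4 * (a + b)))"
  proof -
    have "\<mu>\<^sup>2 * (a + b) - \<mu> * t = \<mu> * (\<mu> * (a + b) - t)"
      by (simp add: power2_eq_square algebra_simps)
    also have "\<mu> * (a + b) = t / 2" using pos by (simp add: \<mu>_def divide_simps algebra_simps)
    finally show ?thesis by (simp add: \<mu>_def power2_eq_square)
  qed
  also have "t\<^sup>2 = (1 - 2 * \<gamma>)\<^sup>2 * (a - b)\<^sup>2"
    by (simp add: t_def power_mult_distrib power2_commute)
  finally show ?thesis by (simp add: tau_sq_def)
qed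

section \<open>Entropy, the number of initial labelings, and solving for u\<close>

lemma binary_entropy_pos: "0 < \<gamma> \<Longrightarrow> \<gamma> < 1 \<Longrightarrow> binary_entropy \<gamma> > 0"
  unfolding binary_entropy_def
  by (smt (verit, best) ln_less_zero mult_minus_left mult_neg_neg mult_pos_neg)

lemma finite_initial_labelings: "finite (initial_labelings \<gamma> n)"
  unfolding initial_labelings_def by (rule finite_subset[of _ "{1..n} \<rightarrow>\<^sub>E UNIV"]) (auto intro: finite_PiE)

lemma initial_labelings_nonempty:
  assumes "n \<in> admissible \<gamma>" "0 < \<gamma>" "\<gamma> < 1"
  shows "initial_labelings \<gamma> n \<noteq> {}"
proof -
  define m where "m = n div 2"
  have n_eq: "n = 2 * m" and "\<gamma> * real m \<in> \<int>" using assms by (auto simp: admissible_def m_def)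
  then obtain z where z: "\<gamma> * real m = of_int z" by (auto elim: Ints_cases)
  define k where "k = nat z"
  have "real_of_int z \<ge> 0" using z assms by (metis mult_nonneg_nonneg less_imp_le of_nat_0_le_iff)
  then have k: "\<gamma> * real m = real k" using z by (simp add: k_def)
  have "real k \<le> 1 * real m" unfolding k[symmetric] using assms by (intro mult_right_mono) auto
  then have km: "k \<le> m" by simp
  \<comment> \<open>In each half the first k nodes receive their true label and the remaining ones
    the wrong label.\<close>
  define e :: "nat \<Rightarrow> 2" where "e = restrict (\<lambda>i. if i \<le> k \<or> i > m + k then 1 else 2) {1..n}"
  have "{1..m} \<inter> {i. e i = 1} = {1..k}" and "{m + 1..n} \<inter> {i. e i = 2} = {m + 1..m + k}"
    using km by (auto simp: e_def n_eq)
  then have "e \<in> initial_labelings \<gamma> n"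
    unfolding initial_labelings_def m_def[symmetric] k by (auto simp: e_def)
  then show ?thesis by blast
qed

text \<open>The product measure giving label \<open>c\<^sub>i\<close> to node \<open>i\<close> with probability \<open>\<gamma>\<close> charges every
  initial labeling with \<open>exp (- n h(\<gamma>))\<close>.\<close>

lemma card_initial_labelings_le:
  assumes n: "n \<in> admissible \<gamma>" and \<gamma>: "0 < \<gamma>" "\<gamma> < 1"
  shows "real (card (initial_labelings \<gamma> n)) \<le> exp (n * binary_entropy \<gamma>)"
proof -
  define f where "f i l = (if l = true_labels n i then \<gamma> else 1 - \<gamma>)" for i l
  have n0: "even n" "n > 0" using n by (auto simp: admissible_def)
  have f_pos: "f i l > 0" for i l using \<gamma> by (simp add: f_def)
  have weight: "(\<Prod>i = 1..n. f i (e i)) = exp (- (n * binary_entropy \<gamma>))"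
    if e: "e \<in> initial_labelings \<gamma> n" for e
  proof -
    have "(\<Prod>i = 1..n. f i (e i)) = exp (\<Sum>i = 1..n. ln (f i (e i)))"
      using f_pos by (simp add: exp_sum)
    \<comment> \<open>The logarithm is ln \<gamma> on agreement and ln (1 - \<gamma>) on
      disagreement, hence affine in the product of the signs.\<close>
    also have "(\<Sum>i = 1..n. ln (f i (e i))) = (\<Sum>i = 1..n. (ln \<gamma> + ln (1 - \<gamma>)) / 2
        + (ln \<gamma> - ln (1 - \<gamma>)) / 2 * (label_sign (true_labels n i) * label_sign (e i)))"
      by (intro sum.cong refl) (auto simp: f_def label_sign_neq field_simps dest: label_sign_neq)
    also have "\<dots> = - (n * binary_entropy \<gamma>)"
      unfolding sum.distrib sum_distrib_left[symmetric] label_sign_sums[OF n e]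
      by (simp add: binary_entropy_def field_simps)
    finally show ?thesis .
  qed
  have "card (initial_labelings \<gamma> n) * exp (- (n * binary_entropy \<gamma>)) =
      (\<Sum>e\<in>initial_labelings \<gamma> n. \<Prod>i = 1..n. f i (e i))"
    using weight by simp
  also have "\<dots> \<le> (\<Sum>e\<in>{1..n} \<rightarrow>\<^sub>E UNIV. \<Prod>i = 1..n. f i (e i))"
    by (intro sum_mono2 finite_PiE prod_nonneg)
      (auto simp: initial_labelings_def intro: less_imp_le f_pos)
  also have "\<dots> = (\<Prod>i = 1..n. \<Sum>l\<in>UNIV. f i l)"
    by (rule prod_sum_PiE[symmetric]) auto
  also have "\<dots> = 1"
    by (intro prod.neutral ballI) (auto simp: sum_2 f_def true_labels_def)
  finally show ?thesis by (simp add: exp_minus field_simps)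
qed

text \<open>Serves to relax the bound exp (- 3 n h) from the union bound to the stated rate. As 4
  \<gamma> (1 - \<gamma>) <= 1, the argument of the logarithm is at least n / pi; n = 2 is
  impossible because \<gamma> would be an integer.\<close>

lemma kappa_nonneg:
  assumes n: "n \<in> admissible \<gamma>" and \<gamma>: "0 < \<gamma>" "\<gamma> < 1"
  shows "kappa \<gamma> n \<ge> 0"
proof -
  have "n \<noteq> 2"
  proof
    assume "n = 2"
    then have "\<gamma> \<in> \<int>" using n by (simp add: admissible_def)
    then show False using \<gamma> by (auto elim!: Ints_cases)
  qed
  then have n4: "n \<ge> 4" using n by (auto simp: admissible_def elim!: evenE)
  have "4 * \<gamma> * (1 - \<gamma>) = 1 - (1 - 2 * \<gamma>)\<^sup>2" by (simp add: power2_eq_square algebra_simps)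
  then have "4 * \<gamma> * (1 - \<gamma>) \<le> 1" by simp
  then have "pi * (4 * \<gamma> * (1 - \<gamma>)) \<le> pi * 1" by (intro mult_left_mono) auto
  also have "\<dots> \<le> real n" using pi_less_4 n4 by linarith
  finally have "1 \<le> real n / (4 * pi * \<gamma> * (1 - \<gamma>))" using \<gamma> by (simp add: algebra_simps)
  then show ?thesis by (simp add: kappa_def)
qed

text \<open>With v = log u this solves log u + log log u = y exactly. At the lower endpoint the two
  summands are at most 1 and y - 1; at the upper one they are at least y and 0.\<close>

lemma exists_add_ln_eq:
  fixes y :: real
  shows "\<exists>v>0. v + ln v = y"
proof -
  let ?lo = "min 1 (exp (y - 1))" and ?hi = "max 1 y"
  have "\<exists>v\<ge>?lo. v \<le> ?hi \<and> v + ln v = y"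
  proof (rule IVT')
    have "ln ?lo \<le> ln (exp (y - 1))" by (subst ln_le_cancel_iff) auto
    then show "?lo + ln ?lo \<le> y" by simp
    have "ln ?hi \<ge> 0" by simp
    then show "y \<le> ?hi + ln ?hi" by linarith
    show "continuous_on {?lo..?hi} (\<lambda>v. v + ln v)"
      by (intro continuous_intros) (auto simp: min_def max_def split: if_splits)
  qed auto
  then show ?thesis by (smt (verit) exp_gt_zero)
qed

section \<open>Mismatch ratio and union bound over the initial labelings\<close>

lemma mismatch_bounds:
  assumes "n > 0"
  shows "0 \<le> mismatch n c c'" "mismatch n c c' \<le> 1"
    "mismatch n c c' \<le> real (card {i \<in> {1..n}. c' i \<noteq> c i}) / n"
proof -
  let ?M = "\<lambda>\<phi>. (1 / real n) * (\<Sum>i = 1..n. of_bool (c' i \<noteq> \<phi> (c i)))"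
  have fin: "finite (?M ` {\<phi>. bij \<phi>})" by simp
  have "mismatch n c c' \<le> ?M id"
    unfolding mismatch_def by (rule Min_le[OF fin], rule imageI) (simp only: mem_Collect_eq bij_id)
  also have "\<dots> = real (card {i \<in> {1..n}. c' i \<noteq> c i}) / n"
    by (simp add: Int_def)
  finally show *: "mismatch n c c' \<le> real (card {i \<in> {1..n}. c' i \<noteq> c i}) / n" .
  have "card {i \<in> {1..n}. c' i \<noteq> c i} \<le> card {1..n}" by (rule card_mono) auto
  then have "real (card {i \<in> {1..n}. c' i \<noteq> c i}) / n \<le> 1" using assms by simp
  with * show "mismatch n c c' \<le> 1" by simp
  have "mismatch n c c' \<in> ?M ` {\<phi>. bij \<phi>}"
    unfolding mismatch_def by (rule Min_in[OF fin]) (use bij_id in blast)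
  then show "0 \<le> mismatch n c c'" by (auto intro!: divide_nonneg_nonneg sum_nonneg)
qed

lemma true_params_mem_param_estimates: "a \<ge> 0 \<Longrightarrow> b \<ge> 0 \<Longrightarrow> a \<noteq> b \<Longrightarrow> (a, b) \<in> param_estimates a b"
  by (auto simp: param_estimates_def zero_less_mult_iff)

text \<open>Contains every node misclassified from e, for all parameter estimates at once. This
  disposes of the supremum over the infinite set \<open>param_estimates\<close> and leaves a union
  bound over e alone.\<close>

definition nonpos_rows :: "real \<Rightarrow> nat \<Rightarrow> real \<Rightarrow> real \<Rightarrow> (nat \<times> nat \<Rightarrow> bool) \<Rightarrow> (nat \<Rightarrow> 2) \<Rightarrow> nat set" where
  "nonpos_rows \<gamma> n a b A e = {i \<in> {1..n}. (\<Sum>j = 1..n. sgn ((2 * \<gamma> - 1) * (a - b)) *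
     label_sign (true_labels n i) * label_sign (e j) * of_bool (A (i, j))) \<le> 0}"

context
  fixes \<gamma> :: real and n :: nat and a b :: real
    and est :: "(nat \<times> nat \<Rightarrow> bool) \<Rightarrow> real \<times> real \<Rightarrow> (nat \<Rightarrow> 2) \<Rightarrow> nat \<Rightarrow> 2"
  assumes n: "n \<in> admissible \<gamma>" and \<gamma>: "0 < \<gamma>" "\<gamma> < 1"
    and ab: "a \<in> {0..real (n div 2)}" "b \<in> {0..real (n div 2)}" "a \<noteq> b"
    and est: "cpl_estimate \<gamma> n a b est"
begin

lemma n_pos: "n > 0" using n by (simp add: admissible_def)

lemma mismatch_est_le:
  assumes "p \<in> param_estimates a b" "e \<in> initial_labelings \<gamma> n"
  shows "mismatch n (true_labels n) (est A p e) \<le> card (nonpos_rows \<gamma> n a b A e) / n"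
proof -
  have "{i \<in> {1..n}. est A p e i \<noteq> true_labels n i} \<subseteq> nonpos_rows \<gamma> n a b A e"
  proof
    fix i assume i: "i \<in> {i \<in> {1..n}. est A p e i \<noteq> true_labels n i}"
    then have "is_arg_max (cpl_score n (true_labels n) (\<lambda>_. 1/2) p e A i) (\<lambda>_. True) (est A p e i)"
      using est assms unfolding cpl_estimate_def by blast
    with i cpl_error_imp_nonpos[OF n assms(2,1) \<gamma>] show "i \<in> nonpos_rows \<gamma> n a b A e"
      unfolding nonpos_rows_def by blast
  qed
  then have "card {i \<in> {1..n}. est A p e i \<noteq> true_labels n i} \<le> card (nonpos_rows \<gamma> n a b A e)"
    by (rule card_mono[rotated]) (simp add: nonpos_rows_def)
  then show ?thesis
    by (intro order_trans[OF mismatch_bounds(3)[OF n_pos]] divide_right_mono) auto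
qed

text \<open>Removes the absolute value in the convergence in probability. A real \<open>SUP\<close>
  is meaningful only for nonempty sets that are bounded above, hence the upper bound 1 along the
  way.\<close>

lemma sup_mismatch_nonneg: "sup_mismatch \<gamma> n a b est A \<ge> 0"
proof -
  let ?E = "initial_labelings \<gamma> n" and ?P = "param_estimates a b"
  let ?f = "\<lambda>p e. mismatch n (true_labels n) (est A p e)"
  obtain e where e: "e \<in> ?E" using initial_labelings_nonempty[OF n \<gamma>] by blast
  have p: "(a, b) \<in> ?P" using ab by (intro true_params_mem_param_estimates) auto
  have inner_le: "(SUP e\<in>?E. ?f p e) \<le> 1" for p
    using e by (intro cSUP_least mismatch_bounds(2) n_pos) auto
  have "0 \<le> ?f (a, b) e" by (rule mismatch_bounds(1)[OF n_pos])
  also have "\<dots> \<le> (SUP e\<in>?E. ?f (a, b) e)"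
    using e by (intro cSUP_upper bdd_aboveI[of _ 1]) (auto intro: mismatch_bounds(2) n_pos)
  also have "\<dots> \<le> (SUP p\<in>?P. SUP e\<in>?E. ?f p e)"
    using p by (intro cSUP_upper bdd_aboveI[of _ 1]) (auto intro: inner_le)
  finally show ?thesis by (simp add: sup_mismatch_def)
qed

text \<open>The maximum over the finitely many initial labelings is attained, so the non-strict
  inequality passes to a single e.\<close>

lemma sup_mismatch_ge_imp:
  fixes x :: real
  assumes "sup_mismatch \<gamma> n a b est A \<ge> x"
  shows "\<exists>e\<in>initial_labelings \<gamma> n. real (card (nonpos_rows \<gamma> n a b A e)) \<ge> n * x"
proof -
  let ?E = "initial_labelings \<gamma> n" and ?N = "\<lambda>e. card (nonpos_rows \<gamma> n a b A e) / real n"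
  have E: "finite (?N ` ?E)" "?N ` ?E \<noteq> {}"
    using finite_initial_labelings initial_labelings_nonempty[OF n \<gamma>] by auto
  have "sup_mismatch \<gamma> n a b est A \<le> Max (?N ` ?E)"
    unfolding sup_mismatch_def
  proof (intro cSUP_least)
    show "param_estimates a b \<noteq> {}" using true_params_mem_param_estimates[of a b] ab by auto
    show "?E \<noteq> {}" using initial_labelings_nonempty[OF n \<gamma>] .
    fix p e assume "p \<in> param_estimates a b" "e \<in> ?E"
    then show "mismatch n (true_labels n) (est A p e) \<le> Max (?N ` ?E)"
      by (intro order_trans[OF mismatch_est_le] Max_ge E) auto
  qed
  moreover obtain e where "e \<in> ?E" "Max (?N ` ?E) = ?N e"
    using Max_in[OF E] by blast
  ultimately have "x \<le> ?N e" using assms by linarith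
  then show ?thesis using \<open>e \<in> ?E\<close> n_pos by (auto simp: field_simps)
qed

lemma prob_sup_mismatch_ge:
  assumes v: "v > 0"
    and v_eq: "v + ln v = ln (4 / exp 1 * binary_entropy \<gamma>) + 1/4 * (1 - 2 * \<gamma>)\<^sup>2 * tau_sq a b"
  shows "measure_pmf.prob (directed_block_model n (true_labels n) (block_matrix n a b))
      {A. sup_mismatch \<gamma> n a b est A \<ge> 4 * binary_entropy \<gamma> / v}
    \<le> exp (- real n * (binary_entropy \<gamma> - kappa \<gamma> n))"
proof -
  define h where "h = binary_entropy \<gamma>"
  define k where "k = n * (4 * h / v)"
  define L where "L = 1/4 * (1 - 2 * \<gamma>)\<^sup>2 * tau_sq a b"
  let ?E = "initial_labelings \<gamma> n"
  let ?law = "directed_block_model n (true_labels n) (block_matrix n a b)"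
  let ?B = "\<lambda>e. {A. real (card (nonpos_rows \<gamma> n a b A e)) \<ge> k}"
  have n0: "even n" using n by (auto simp: admissible_def)
  have h: "h > 0" unfolding h_def by (rule binary_entropy_pos[OF \<gamma>])
  have k: "k > 0" using n_pos h v by (simp add: k_def)
  \<comment> \<open>Here ln (k / n) = ln (4 h) - ln v, while \<open>v_eq\<close> says v + ln v = ln
    (4 h) - 1 + L. The Chernoff exponent is thus k v = 4 n h.\<close>
  have "ln (k / n) + L - 1 = v"
    using h v v_eq n_pos by (simp add: k_def h_def[symmetric] L_def ln_div ln_mult)
  then have k_v: "ln (k / card {1..n}) + L - 1 = v" by simp
  have kv: "k * v = 4 * n * h" using v by (simp add: k_def)
  have B: "measure_pmf.prob ?law (?B e) \<le> exp (- (4 * n * h))" if e: "e \<in> ?E" for e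
  proof -
    have q: "0 \<le> block_matrix n a b $ true_labels n i $ true_labels n j \<and>
        block_matrix n a b $ true_labels n i $ true_labels n j \<le> 1" for i j
      using ab n0 n_pos by (auto simp: block_matrix_nth label_sign_def elim!: evenE)
    have "measure_pmf.prob ?law (?B e) \<le> exp (- k * (ln (k / card {1..n}) + L - 1))"
      unfolding directed_block_model_def nonpos_rows_def
    proof (rule prob_many_nonpos_rows_le)
      show "(\<Sum>j = 1..n. block_matrix n a b $ true_labels n i $ true_labels n j *
          (exp (- (\<bar>(2 * \<gamma> - 1) * (a - b)\<bar> / (2 * (a + b))) *
            (sgn ((2 * \<gamma> - 1) * (a - b)) * label_sign (true_labels n i) * label_sign (e j))) - 1)) \<le> - L" for i
        unfolding L_def using ab by (intro row_exponent_le n e \<gamma>) auto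
      show "0 \<le> ln (k / real (card {1..n})) + L" using k_v v by linarith
    qed (use q k ab n_pos in auto)
    then show ?thesis unfolding k_v using kv by simp
  qed
  have "measure_pmf.prob ?law {A. sup_mismatch \<gamma> n a b est A \<ge> 4 * h / v}
      \<le> measure_pmf.prob ?law (\<Union>e\<in>?E. ?B e)"
  proof (rule measure_pmf.finite_measure_mono)
    show "{A. sup_mismatch \<gamma> n a b est A \<ge> 4 * h / v} \<subseteq> (\<Union>e\<in>?E. ?B e)"
    proof
      fix A assume "A \<in> {A. sup_mismatch \<gamma> n a b est A \<ge> 4 * h / v}"
      then have "sup_mismatch \<gamma> n a b est A \<ge> 4 * h / v" by simp
      from sup_mismatch_ge_imp[OF this] show "A \<in> (\<Union>e\<in>?E. ?B e)" by (simp add: k_def)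
    qed
  qed simp
  also have "\<dots> \<le> (\<Sum>e\<in>?E. measure_pmf.prob ?law (?B e))"
    by (rule measure_UNION_le[OF finite_initial_labelings]) auto
  also have "\<dots> \<le> card ?E * exp (- (4 * n * h))"
    by (rule sum_bounded_above[OF B])
  also have "\<dots> \<le> exp (n * h) * exp (- (4 * n * h))"
    using card_initial_labelings_le[OF n \<gamma>] by (simp add: h_def)
  also have "\<dots> = exp (- n * h + - 2 * (n * h))" by (simp add: exp_add[symmetric])
  also have "\<dots> \<le> exp (- n * (h - kappa \<gamma> n))"
  proof -
    have "0 \<le> n * h" "0 \<le> n * kappa \<gamma> n" using h kappa_nonneg[OF n \<gamma>] by simp_all
    then show ?thesis by (simp add: algebra_simps)
  qed
  finally show ?thesis by (simp add: h_def)
qed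

end

section \<open>Limits along the admissible n and the final result\<close>

lemma kappa_tendsto_0:
  assumes "0 < \<gamma>" "\<gamma> < 1"
  shows "kappa \<gamma> \<longlonglongrightarrow> 0"
proof -
  define C where "C = 4 * pi * \<gamma> * (1 - \<gamma>)"
  have "C > 0" using assms by (simp add: C_def)
  then show ?thesis unfolding kappa_def C_def[symmetric] by real_asymp
qed

lemma exp_rate_tendsto_0:
  assumes \<gamma>: "0 < \<gamma>" "\<gamma> < 1"
  shows "(\<lambda>n. exp (- real n * (binary_entropy \<gamma> - kappa \<gamma> n))) \<longlonglongrightarrow> 0"
proof -
  define h where "h = binary_entropy \<gamma>"
  have "h > 0" using binary_entropy_pos[OF \<gamma>] by (simp add: h_def)
  moreover have "(\<lambda>n. h - kappa \<gamma> n) \<longlonglongrightarrow> h"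
    using tendsto_diff[OF tendsto_const kappa_tendsto_0[OF \<gamma>]] by simp
  ultimately have "filterlim (\<lambda>n. (h - kappa \<gamma> n) * real n) at_top sequentially"
    by (intro filterlim_tendsto_pos_mult_at_top filterlim_real_sequentially)
  then have "filterlim (\<lambda>n. - ((h - kappa \<gamma> n) * real n)) at_bot sequentially"
    by (simp add: filterlim_uminus_at_top)
  then show ?thesis
    using filterlim_compose[OF exp_at_bot] by (simp add: h_def mult.commute)
qed

theorem theorem1:
  fixes \<gamma> :: real
    and a b :: "nat \<Rightarrow> real"
    and est :: "nat \<Rightarrow> (nat \<times> nat \<Rightarrow> bool) \<Rightarrow> real \<times> real \<Rightarrow> (nat \<Rightarrow> 2) \<Rightarrow> nat \<Rightarrow> 2"
  defines "law \<equiv> \<lambda>n. directed_block_model n (true_labels n) (block_matrix n (a n) (b n))"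
  assumes "\<gamma> \<in> {0<..<1} - {1/2}"
    and "\<And>n. n \<in> admissible \<gamma> \<Longrightarrow> a n \<in> {0..real (n div 2)}"
    and "\<And>n. n \<in> admissible \<gamma> \<Longrightarrow> b n \<in> {0..real (n div 2)}"
    and "\<And>n. n \<in> admissible \<gamma> \<Longrightarrow> a n \<noteq> b n"
    and "\<And>n. n \<in> admissible \<gamma> \<Longrightarrow> cpl_estimate \<gamma> n (a n) (b n) (est n)"
  shows "\<exists>u :: nat \<Rightarrow> real.
    (\<forall>n \<in> admissible \<gamma>.
       u n > 1 \<and>
       ln (u n) + ln (ln (u n)) \<ge>
         ln (4 / exp 1 * binary_entropy \<gamma>) + 1/4 * (1 - 2 * \<gamma>)\<^sup>2 * tau_sq (a n) (b n) \<and>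
       measure_pmf.prob (law n)
         {A. sup_mismatch \<gamma> n (a n) (b n) (est n) A \<ge> 4 * binary_entropy \<gamma> / ln (u n)}
         \<le> exp (- real n * (binary_entropy \<gamma> - kappa \<gamma> n))) \<and>
    kappa \<gamma> \<in> o[along \<gamma>](\<lambda>_. 1) \<and>
    (filterlim (\<lambda>n. tau_sq (a n) (b n)) at_top (along \<gamma>) \<longrightarrow>
       filterlim u at_top (along \<gamma>) \<and>
       (\<forall>\<epsilon>>0. ((\<lambda>n. measure_pmf.prob (law n)
          {A. \<bar>sup_mismatch \<gamma> n (a n) (b n) (est n) A\<bar> > \<epsilon>}) \<longlongrightarrow> 0) (along \<gamma>)))"
proof -
  have \<gamma>: "0 < \<gamma>" "\<gamma> < 1" "\<gamma> \<noteq> 1/2" using assms(2) by auto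
  note model = assms(3-6)
  define h where "h = binary_entropy \<gamma>"
  have h: "h > 0" using binary_entropy_pos[OF \<gamma>(1,2)] by (simp add: h_def)
  define C where "C = 1/4 * (1 - 2 * \<gamma>)\<^sup>2"
  have C: "C > 0" using \<gamma> by (simp add: C_def)
  define y where "y n = ln (4 / exp 1 * h) + C * tau_sq (a n) (b n)" for n
  obtain f where f: "\<And>y :: real. f y > 0" "\<And>y. f y + ln (f y) = y"
    using exists_add_ln_eq by metis
  \<comment> \<open>The witness is u = exp v, so u > 1 amounts to v > 0 and the required inequality
    holds with equality.\<close>
  define v where "v n = f (y n)" for n
  have v_pos: "v n > 0" and v_eq: "v n + ln (v n) = y n" for n
    by (simp_all add: v_def f)
  have along: "along \<gamma> \<le> sequentially" by (simp add: along_def)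
  have adm: "\<forall>\<^sub>F n in along \<gamma>. n \<in> admissible \<gamma>"
    by (simp add: along_def eventually_inf_principal)
  have prob: "measure_pmf.prob (law n) {A. sup_mismatch \<gamma> n (a n) (b n) (est n) A \<ge> 4 * h / v n}
      \<le> exp (- real n * (h - kappa \<gamma> n))" if n: "n \<in> admissible \<gamma>" for n
    unfolding law_def h_def
    using prob_sup_mismatch_ge[OF n \<gamma>(1,2) model[OF n] v_pos] v_eq[of n]
    by (simp add: y_def h_def C_def)
  have first: "\<forall>n \<in> admissible \<gamma>. exp (v n) > 1 \<and>
       ln (exp (v n)) + ln (ln (exp (v n))) \<ge> y n \<and>
       measure_pmf.prob (law n)
         {A. sup_mismatch \<gamma> n (a n) (b n) (est n) A \<ge> 4 * h / ln (exp (v n))}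
         \<le> exp (- real n * (h - kappa \<gamma> n))"
    using prob v_pos v_eq by simp
  have kappa: "kappa \<gamma> \<in> o[along \<gamma>](\<lambda>_. 1)"
    by (rule smalloI_tendsto) (use filterlim_mono[OF kappa_tendsto_0[OF \<gamma>(1,2)] order_refl along] in auto)
  have last: "filterlim (\<lambda>n. exp (v n)) at_top (along \<gamma>) \<and>
       (\<forall>\<epsilon>>0. ((\<lambda>n. measure_pmf.prob (law n)
          {A. \<bar>sup_mismatch \<gamma> n (a n) (b n) (est n) A\<bar> > \<epsilon>}) \<longlongrightarrow> 0) (along \<gamma>))"
    if \<tau>: "filterlim (\<lambda>n. tau_sq (a n) (b n)) at_top (along \<gamma>)"
  proof (intro conjI allI impI)
    have "filterlim y at_top (along \<gamma>)"
      unfolding y_def using C \<tau>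
      by (intro filterlim_tendsto_add_at_top[OF tendsto_const]
          filterlim_tendsto_pos_mult_at_top[OF tendsto_const])
    then have "filterlim (\<lambda>n. 1/2 * y n) at_top (along \<gamma>)"
      by (intro filterlim_tendsto_pos_mult_at_top[OF tendsto_const]) auto
    \<comment> \<open>Since ln v <= v, the equation v + ln v = y gives y <= 2 v.\<close>
    moreover have "1/2 * y n \<le> v n" for n
      using v_eq[of n] ln_bound[OF v_pos[of n]] by simp
    ultimately have v_lim: "filterlim v at_top (along \<gamma>)"
      by (auto intro: filterlim_at_top_mono)
    then show "filterlim (\<lambda>n. exp (v n)) at_top (along \<gamma>)"
      by (rule filterlim_compose[OF exp_at_top])
    fix \<epsilon> :: real assume \<epsilon>: "\<epsilon> > 0"
    \<comment> \<open>Once the threshold 4 h / v is at most \<epsilon>, exceeding \<epsilon> implies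
      the event already bounded in \<open>prob\<close>.\<close>
    have "\<forall>\<^sub>F n in along \<gamma>. 4 * h / \<epsilon> \<le> v n"
      using v_lim by (simp add: filterlim_at_top)
    then have bound: "\<forall>\<^sub>F n in along \<gamma>. measure_pmf.prob (law n)
        {A. \<bar>sup_mismatch \<gamma> n (a n) (b n) (est n) A\<bar> > \<epsilon>} \<le> exp (- real n * (h - kappa \<gamma> n))"
      using adm
    proof eventually_elim
      case (elim n)
      have "4 * h / v n \<le> \<epsilon>" using elim(1) \<epsilon> v_pos[of n] by (simp add: field_simps)
      then have "{A. \<bar>sup_mismatch \<gamma> n (a n) (b n) (est n) A\<bar> > \<epsilon>}
          \<subseteq> {A. sup_mismatch \<gamma> n (a n) (b n) (est n) A \<ge> 4 * h / v n}"
        using sup_mismatch_nonneg[OF elim(2) \<gamma>(1,2) model[OF elim(2)]] by force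
      then show ?case
        by (rule order_trans[OF measure_pmf.finite_measure_mono prob[OF elim(2)]]) auto
    qed
    have lim: "((\<lambda>n. exp (- real n * (h - kappa \<gamma> n))) \<longlongrightarrow> 0) (along \<gamma>)"
      using filterlim_mono[OF exp_rate_tendsto_0[OF \<gamma>(1,2)] order_refl along] by (simp add: h_def)
    show "((\<lambda>n. measure_pmf.prob (law n)
        {A. \<bar>sup_mismatch \<gamma> n (a n) (b n) (est n) A\<bar> > \<epsilon>}) \<longlongrightarrow> 0) (along \<gamma>)"
      by (rule tendsto_sandwich[OF _ bound tendsto_const lim]) simp
  qed
  show ?thesis
    using first kappa last unfolding y_def h_def C_def
    by (intro exI[of _ "\<lambda>n. exp (v n)"]) blast
qed

end
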